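(* For almost every graph on $\mathbb{N}$, every set $A \subseteq \mathbb{N}$ of positive upper density is universal.
   Context: $\mathbb{N}=\{1,2,3,\dots\}$. All graphs are simple and undirected. A random graph on $\mathbb{N}$ is formed by including each pair $\{m,n\}$ ($m\neq n$) as an edge independently with probability $\tfrac12$; "almost every graph on $\mathbb{N}$ has property $P$" means that this random graph has property $P$ with probability $1$. For a fixed graph on $\mathbb{N}$, a set $A\subseteq\mathbb{N}$ is universal if the induced subgraph on $A$ contains every countable graph as an induced subgraph. The upper density of $A$ is $\limsup_{n\to\infty}|A\cap[1,n]|/n$. *)

theory Defs
  imports "HOL-Probability.Probability"
begin

definition all_pairs :: "'a set \<Rightarrow> 'a set set" where
  "all_pairs V = {{u, v} | u v. u \<in> V \<and> v \<in> V \<and> u \<noteq> v}"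

definition simple_graph :: "'a set \<Rightarrow> 'a set set \<Rightarrow> bool" where
  "simple_graph V E \<longleftrightarrow> E \<subseteq> all_pairs V"

definition induced_edges :: "'a set set \<Rightarrow> 'a set \<Rightarrow> 'a set set" where
  "induced_edges E A = {e \<in> E. e \<subseteq> A}"

definition graph_isomorphic :: "'a set \<Rightarrow> 'a set set \<Rightarrow> 'b set \<Rightarrow> 'b set set \<Rightarrow> bool" where
  "graph_isomorphic V E W F \<longleftrightarrow>
     (\<exists>f. bij_betw f V W \<and> (\<forall>u\<in>V. \<forall>v\<in>V. {u, v} \<in> E \<longleftrightarrow> {f u, f v} \<in> F))"

definition contains_induced :: "'a set \<Rightarrow> 'a set set \<Rightarrow> 'b set \<Rightarrow> 'b set set \<Rightarrow> bool" where
  "contains_induced V E W F \<longleftrightarrow> (\<exists>B\<subseteq>V. graph_isomorphic W F B (induced_edges E B))"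

text \<open>
  Countable graphs (finite ones included) are represented, up to isomorphism, by the graphs whose
  vertex set is any set of natural numbers; \<open>universal_contains_countable\<close> below recovers
  countable graphs over an arbitrary type.
\<close>

definition universal :: "'a set set \<Rightarrow> 'a set \<Rightarrow> bool" where
  "universal E A \<longleftrightarrow>
     (\<forall>(W :: nat set) F. simple_graph W F \<longrightarrow> contains_induced A (induced_edges E A) W F)"

lemma universal_contains_countable:
  fixes W :: "'b set"
  assumes "universal E A" "countable W" "simple_graph W F"
  shows "contains_induced A (induced_edges E A) W F"
proof -
  define g where "g = to_nat_on W"
  have inj: "inj_on g W"
    unfolding g_def using assms(2) by (rule inj_on_to_nat_on)
  define F' where "F' = {{g u, g v} | u v. u \<in> W \<and> v \<in> W \<and> {u, v} \<in> F}"
  have irrefl: "u \<noteq> v" if "{u, v} \<in> F" for u v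
    using assms(3) that by (auto simp: simple_graph_def all_pairs_def doubleton_eq_iff)
  have "simple_graph (g ` W) F'"
    unfolding simple_graph_def all_pairs_def F'_def
    using irrefl inj by (fastforce dest: inj_onD)
  then obtain B f where B: "B \<subseteq> A" "bij_betw f (g ` W) B"
    and f: "\<And>x y. x \<in> g ` W \<Longrightarrow> y \<in> g ` W \<Longrightarrow>
      {x, y} \<in> F' \<longleftrightarrow> {f x, f y} \<in> induced_edges (induced_edges E A) B"
    using assms(1) unfolding universal_def contains_induced_def graph_isomorphic_def by meson
  have g: "{g u, g v} \<in> F' \<longleftrightarrow> {u, v} \<in> F" if "u \<in> W" "v \<in> W" for u v
  proof
    assume "{g u, g v} \<in> F'"
    then obtain u' v' where *: "u' \<in> W" "v' \<in> W" "{u', v'} \<in> F" "{g u, g v} = {g u', g v'}"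
      unfolding F'_def by blast
    then have "u = u' \<and> v = v' \<or> u = v' \<and> v = u'"
      using that inj by (auto simp: doubleton_eq_iff dest: inj_onD)
    with * show "{u, v} \<in> F"
      by (auto simp: insert_commute)
  qed (use that in \<open>auto simp: F'_def\<close>)
  have "bij_betw (f \<circ> g) W B"
    using inj B(2) by (intro bij_betw_trans[of g W "g ` W"]) (auto simp: bij_betw_def)
  then show ?thesis
    unfolding contains_induced_def graph_isomorphic_def using B(1) f g by (metis comp_apply imageI)
qed

definition upper_density :: "nat set \<Rightarrow> ereal" where
  "upper_density A = limsup (\<lambda>n. ereal (real (card (A \<inter> {1..n})) / real n))"

text \<open>The library type \<^typ>\<open>nat\<close> contains 0, so the vertex set is \<open>{1..}\<close>.\<close>

definition edge_coin_space :: "(nat set \<Rightarrow> bool) measure" where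
  "edge_coin_space =
     (\<Pi>\<^sub>M e \<in> all_pairs {1..}. measure_pmf (bernoulli_pmf (1/2)))"

text \<open>
  A graph on \<open>{1..}\<close> is given by its edge set. No measurability of \<open>P\<close> is presupposed:
  \<open>AE\<close> says that \<open>P\<close> fails only inside a measurable event of probability 0.
\<close>

definition almost_every_graph :: "(nat set set \<Rightarrow> bool) \<Rightarrow> bool" where
  "almost_every_graph P \<longleftrightarrow>
     (AE \<omega> in edge_coin_space. P {e \<in> all_pairs {1..}. \<omega> e})"

end

theory Submission
  imports Defs
begin

text \<open>
  Almost surely, for every finite set \<open>S\<close> of vertices, the common neighbours of \<open>S\<close>, and likewise
  its common non-neighbours, have upper density at most $2 \cdot 2^{-|S|}$ (Hoeffding and
  Borel--Cantelli). Fix such a graph and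
  let \<open>A\<close> have positive upper density. If \<open>S\<close> consists of vertices \<open>v\<close> for which \<open>A \<inter> N(v)\<close> has
  density zero, then up to density zero \<open>A\<close> is contained in the set of common non-neighbours
  of \<open>S\<close>, so \<open>|S|\<close> is bounded. Hence all but finitely many \<open>v\<close> split \<open>A\<close> into two parts of positive
  upper density. A countable graph can therefore be embedded greedily, keeping the
  set of vertices of \<open>A\<close> of every adjacency type over the vertices chosen so far at positive upper
  density.
\<close>

section \<open>Sets of density zero\<close>

definition density_zero :: "nat set \<Rightarrow> bool" where
  "density_zero A \<longleftrightarrow> (\<lambda>n. real (card (A \<inter> {1..n})) / real n) \<longlonglongrightarrow> 0"

text \<open>The ratios are nonnegative, so a limsup of 0 already forces convergence to 0. The
  hypothesis thus becomes the failure of a smallness notion that passes to subsets and finite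
  unions.\<close>

lemma upper_density_pos_iff: "upper_density A > 0 \<longleftrightarrow> \<not> density_zero A"
proof -
  let ?f = "\<lambda>n. ereal (real (card (A \<inter> {1..n})) / real n)"
  have nonneg: "0 \<le> liminf ?f"
    by (intro Liminf_bounded) auto
  have le: "liminf ?f \<le> limsup ?f"
    by (intro Liminf_le_Limsup) auto
  have "density_zero A \<longleftrightarrow> ?f \<longlonglongrightarrow> 0"
    by (simp add: density_zero_def zero_ereal_def)
  also have "\<dots> \<longleftrightarrow> liminf ?f = 0 \<and> limsup ?f = 0"
    by (intro tendsto_iff_Liminf_eq_Limsup) auto
  also have "\<dots> \<longleftrightarrow> \<not> upper_density A > 0"
    using nonneg le unfolding upper_density_def by auto
  finally show ?thesis by blast
qed

text \<open>Clearing the denominator turns the limit into bounds on counts, which add up over unions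
  and compare directly with the pseudorandomness bound.\<close>

lemma density_zero_iff:
  "density_zero A \<longleftrightarrow>
     (\<forall>\<epsilon>>0. \<forall>\<^sub>F n in sequentially. real (card (A \<inter> {1..n})) \<le> \<epsilon> * real n)"
proof
  assume *: "density_zero A"
  show "\<forall>\<epsilon>>0. \<forall>\<^sub>F n in sequentially. real (card (A \<inter> {1..n})) \<le> \<epsilon> * real n"
  proof (intro allI impI)
    fix \<epsilon> :: real assume "\<epsilon> > 0"
    then have "\<forall>\<^sub>F n in sequentially. real (card (A \<inter> {1..n})) / real n < \<epsilon>"
      using * unfolding density_zero_def by (auto dest: order_tendstoD)
    then show "\<forall>\<^sub>F n in sequentially. real (card (A \<inter> {1..n})) \<le> \<epsilon> * real n"
      using eventually_gt_at_top[of 0] by eventually_elim (simp add: field_simps)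
  qed
next
  assume *: "\<forall>\<epsilon>>0. \<forall>\<^sub>F n in sequentially. real (card (A \<inter> {1..n})) \<le> \<epsilon> * real n"
  show "density_zero A"
    unfolding density_zero_def
  proof (rule order_tendstoI)
    fix e :: real assume "e > 0"
    then have "\<forall>\<^sub>F n in sequentially. real (card (A \<inter> {1..n})) \<le> e / 2 * real n"
      using * by (meson half_gt_zero)
    then show "\<forall>\<^sub>F n in sequentially. real (card (A \<inter> {1..n})) / real n < e"
      using eventually_gt_at_top[of 0]
    proof eventually_elim
      case (elim n)
      then have "real (card (A \<inter> {1..n})) / real n \<le> e / 2"
        by (simp add: field_simps)
      then show ?case using \<open>e > 0\<close> by linarith
    qed
  next
    fix e :: real assume "e < 0"
    then show "\<forall>\<^sub>F n in sequentially. e < real (card (A \<inter> {1..n})) / real n"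
      by (intro always_eventually allI) (rule less_le_trans, auto)
  qed
qed

lemma density_zero_subset:
  assumes "density_zero B" "A \<subseteq> B"
  shows "density_zero A"
  unfolding density_zero_iff
proof (intro allI impI)
  fix \<epsilon> :: real assume "\<epsilon> > 0"
  then have "\<forall>\<^sub>F n in sequentially. real (card (B \<inter> {1..n})) \<le> \<epsilon> * real n"
    using assms(1) by (simp add: density_zero_iff)
  then show "\<forall>\<^sub>F n in sequentially. real (card (A \<inter> {1..n})) \<le> \<epsilon> * real n"
  proof eventually_elim
    case (elim n)
    have "card (A \<inter> {1..n}) \<le> card (B \<inter> {1..n})"
      using assms(2) by (intro card_mono) auto
    then show ?case using elim by linarith
  qed
qed

lemma density_zero_Un:
  assumes "density_zero A" "density_zero B"
  shows "density_zero (A \<union> B)"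
  unfolding density_zero_iff
proof (intro allI impI)
  fix \<epsilon> :: real assume "\<epsilon> > 0"
  then have "\<forall>\<^sub>F n in sequentially. real (card (A \<inter> {1..n})) \<le> \<epsilon> / 2 * real n"
    "\<forall>\<^sub>F n in sequentially. real (card (B \<inter> {1..n})) \<le> \<epsilon> / 2 * real n"
    using assms unfolding density_zero_iff by (metis half_gt_zero)+
  then show "\<forall>\<^sub>F n in sequentially. real (card ((A \<union> B) \<inter> {1..n})) \<le> \<epsilon> * real n"
  proof eventually_elim
    case (elim n)
    have "card ((A \<union> B) \<inter> {1..n}) \<le> card (A \<inter> {1..n}) + card (B \<inter> {1..n})"
      unfolding Int_Un_distrib2 by (rule card_Un_le)
    then show ?case using elim by (simp add: field_simps)
  qed
qed

lemma density_zero_finite: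
  assumes "finite A"
  shows "density_zero A"
  unfolding density_zero_def
proof (rule Lim_null_comparison)
  show "\<forall>\<^sub>F n in sequentially. norm (real (card (A \<inter> {1..n})) / real n) \<le> real (card A) / real n"
    using assms by (intro always_eventually allI) (auto intro!: divide_right_mono card_mono)
qed (rule lim_const_over_n)

lemma density_zero_UN:
  assumes "finite S" "\<And>v. v \<in> S \<Longrightarrow> density_zero (A v)"
  shows "density_zero (\<Union>v\<in>S. A v)"
  using assms by (induction S) (auto intro: density_zero_finite density_zero_Un)

section \<open>Blocks of fair coins\<close>

text \<open>Points of a product space are extensional, so restriction to \<open>I\<close> is the
  identity and the joint law of the coordinates is \<open>PiM I M\<close> itself, the product of the
  marginals. This is the distributional criterion for independence.\<close>

lemma indep_vars_PiM_coordinates: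
  assumes "\<And>i. i \<in> I \<Longrightarrow> prob_space (M i)" "I \<noteq> {}"
  shows "prob_space.indep_vars (PiM I M) M (\<lambda>i \<omega>. \<omega> i) I"
proof -
  interpret prob_space "PiM I M"
    using assms(1) by (rule prob_space_PiM)
  have "distr (PiM I M) (PiM I M) (\<lambda>\<omega>. restrict \<omega> I) = distr (PiM I M) (PiM I M) (\<lambda>\<omega>. \<omega>)"
    by (intro distr_cong) (auto simp: space_PiM)
  also have "\<dots> = PiM I (\<lambda>i. distr (PiM I M) (M i) (\<lambda>\<omega>. \<omega> i))"
    using assms(1) by (auto simp: distr_PiM_component intro!: PiM_cong)
  finally show ?thesis
    using assms(2) by (subst indep_vars_iff_distr_eq_PiM') auto
qed

text \<open>A block is constantly \<open>b\<close> with probability \<open>p = (1/2) ^ r\<close>,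
  and disjoint blocks are independent. At most \<open>n\<close> blocks give mean at most
  \<open>p * n\<close>; Hoeffding makes an excess of a further \<open>p * n\<close> exponentially
  unlikely, and Borel-Cantelli applies. Hence the factor 2.\<close>

lemma AE_coin_blocks:
  fixes I :: "'i set" and K :: "nat \<Rightarrow> 'i set" and b :: bool
  defines "M \<equiv> (\<Pi>\<^sub>M e\<in>I. measure_pmf (bernoulli_pmf (1/2)))"
  assumes K: "\<And>j. j \<in> J \<Longrightarrow> K j \<subseteq> I" "\<And>j. j \<in> J \<Longrightarrow> finite (K j)" "\<And>j. j \<in> J \<Longrightarrow> card (K j) = r"
    and disj: "disjoint_family_on K J"
  shows "AE \<omega> in M. \<forall>\<^sub>F n in sequentially.
           real (card {j \<in> J \<inter> {1..n}. \<forall>e\<in>K j. \<omega> e = b}) \<le> 2 * (1/2) ^ r * real n"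
proof -
  interpret product_prob_space "\<lambda>_. measure_pmf (bernoulli_pmf (1/2))" I
    by unfold_locales
  interpret M: prob_space M
    unfolding M_def by (rule prob_space_PiM) (rule measure_pmf.prob_space_axioms)
  define p :: real where "p = (1/2) ^ r"
  have p: "p > 0" by (simp add: p_def)
  define Z where "Z j \<omega> = (if \<forall>e\<in>K j. \<omega> e = b then 1 else 0 :: real)" for j \<omega>
  have coord: "(\<lambda>\<omega>. \<omega> e) \<in> measurable M (count_space UNIV)" if "e \<in> I" for e
    using measurable_component_singleton[OF that, of "\<lambda>_. measure_pmf (bernoulli_pmf (1/2))"]
    unfolding M_def by simp
  \<comment> \<open>Measurability is needed on the block's own product space here, since
    independence is obtained by composing with the restriction to \<open>K j\<close>;
    \<open>event\<close> is the version on \<open>M\<close>.\<close>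
  have block: "Measurable.pred (PiM (K j) (\<lambda>_. measure_pmf (bernoulli_pmf (1/2)))) (\<lambda>\<omega>. \<forall>e\<in>K j. \<omega> e = b)"
    if "j \<in> J" for j
  proof (rule pred_intros_finite(3)[OF K(2)[OF that]])
    fix e assume e: "e \<in> K j"
    have "(\<lambda>\<omega>. \<omega> e) \<in> measurable (PiM (K j) (\<lambda>_. measure_pmf (bernoulli_pmf (1/2)))) (count_space UNIV)"
      using measurable_component_singleton[OF e, of "\<lambda>_. measure_pmf (bernoulli_pmf (1/2))"] by simp
    then show "Measurable.pred (PiM (K j) (\<lambda>_. measure_pmf (bernoulli_pmf (1/2)))) (\<lambda>\<omega>. \<omega> e = b)"
      by measurable
  qed
  have event: "Measurable.pred M (\<lambda>\<omega>. \<forall>e\<in>K j. \<omega> e = b)" if "j \<in> J" for j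
  proof (rule pred_intros_finite(3)[OF K(2)[OF that]])
    fix e assume "e \<in> K j"
    then have "e \<in> I" using K(1) that by blast
    from coord[OF this] show "Measurable.pred M (\<lambda>\<omega>. \<omega> e = b)" by measurable
  qed
  have Z_borel: "Z j \<in> borel_measurable M" if "j \<in> J" for j
    unfolding Z_def using event[OF that] by measurable
  have Z_mean: "M.expectation (Z j) = p" if "j \<in> J" for j
  proof -
    have "emeasure M {\<omega> \<in> space M. \<forall>e\<in>K j. \<omega> e \<in> {b}} = (\<Prod>e\<in>K j. emeasure (measure_pmf (bernoulli_pmf (1/2))) {b})"
      unfolding M_def using K that by (intro emeasure_PiM_Collect) auto
    also have "\<dots> = ennreal (1/2) ^ r"
      using K(3)[OF that] by (cases b) (simp_all add: emeasure_pmf_single)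
    also have "\<dots> = ennreal p"
      unfolding p_def by (rule ennreal_power) simp
    finally have "M.prob {\<omega> \<in> space M. \<forall>e\<in>K j. \<omega> e = b} = p"
      using p by (simp add: measure_def)
    moreover have "M.expectation (Z j) = M.expectation (indicator {\<omega> \<in> space M. \<forall>e\<in>K j. \<omega> e = b})"
      by (intro Bochner_Integration.integral_cong) (auto simp: Z_def)
    ultimately show ?thesis using event[OF that] by simp
  qed
  have Z_indep: "M.indep_vars (\<lambda>_. borel) Z J'" if J': "J' \<subseteq> J" and "I \<noteq> {}" for J'
  proof -
    have "M.indep_vars (\<lambda>_. measure_pmf (bernoulli_pmf (1/2))) (\<lambda>e \<omega>. \<omega> e) I"
      unfolding M_def using \<open>I \<noteq> {}\<close>
      by (intro indep_vars_PiM_coordinates measure_pmf.prob_space_axioms)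
    then have "M.indep_vars (\<lambda>j. PiM (K j) (\<lambda>_. measure_pmf (bernoulli_pmf (1/2))))
        (\<lambda>j \<omega>. restrict (\<lambda>e. \<omega> e) (K j)) J'"
      using K(1) J' disjoint_family_on_mono[OF J' disj]
      by (intro M.indep_vars_restrict) auto
    then have "M.indep_vars (\<lambda>_. borel) (\<lambda>j \<omega>. Z j (restrict (\<lambda>e. \<omega> e) (K j))) J'"
    proof (rule M.indep_vars_compose2)
      fix j assume "j \<in> J'"
      then have "j \<in> J" using J' by blast
      from block[OF this]
      show "Z j \<in> borel_measurable (PiM (K j) (\<lambda>_. measure_pmf (bernoulli_pmf (1/2))))"
        unfolding Z_def by measurable
    qed
    moreover have "Z j (restrict (\<lambda>e. \<omega> e) (K j)) = Z j \<omega>" for j \<omega>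
      by (simp add: Z_def)
    ultimately show ?thesis by simp
  qed
  define A where "A n = {\<omega> \<in> space M. (\<Sum>j\<in>J \<inter> {1..n}. Z j \<omega>) > 2 * p * real n}" for n
  have A_sets: "A n \<in> sets M" for n
  proof -
    have "(\<lambda>\<omega>. \<Sum>j\<in>J \<inter> {1..n}. Z j \<omega>) \<in> borel_measurable M"
      using Z_borel by (intro borel_measurable_sum) auto
    then show ?thesis unfolding A_def by measurable
  qed
  have A_prob: "M.prob (A n) \<le> exp (- 2 * p\<^sup>2) ^ n" for n
  \<comment> \<open>Two degenerate cases lie outside Hoeffding's inequality: no summands, or no
    coins at all. Without coins every block is empty, so \<open>r = 0\<close>, \<open>p = 1\<close>,
    and the threshold \<open>2 * n\<close> exceeds any sum of at most \<open>n\<close>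
    indicators.\<close>
  proof (cases "J \<inter> {1..n} = {} \<or> I = {}")
    case True
    have Z_le: "(\<Sum>j\<in>J \<inter> {1..n}. Z j \<omega>) \<le> real n" for \<omega>
    proof -
      have "(\<Sum>j\<in>J \<inter> {1..n}. Z j \<omega>) \<le> (\<Sum>j\<in>{1..n}. 1)"
        by (rule sum_le_included[where i = id]) (auto simp: Z_def)
      then show ?thesis by simp
    qed
    have "A n = {}"
    proof (cases "J \<inter> {1..n} = {}")
      case True
      have "\<not> (2 * p * real n < 0)"
        using p by (simp add: not_less)
      then show ?thesis using True by (simp add: A_def)
    next
      case False
      then obtain j where "j \<in> J" by blast
      then have "r = 0" using K(1,3)[of j] True False by auto
      then have "\<not> 2 * p * real n < (\<Sum>j\<in>J \<inter> {1..n}. Z j \<omega>)" for \<omega>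
        using Z_le[of \<omega>] by (simp add: p_def not_less)
      then show ?thesis by (simp add: A_def)
    qed
    then show ?thesis by simp
  next
    case False
    let ?J = "J \<inter> {1..n}"
    define m where "m = card ?J"
    have m: "m > 0" "m \<le> n"
    proof -
      show "m > 0" using False by (simp add: m_def card_gt_0_iff)
      have "m \<le> card {1..n}" unfolding m_def by (intro card_mono) auto
      then show "m \<le> n" by simp
    qed
    interpret H: Hoeffding_ineq M ?J Z "\<lambda>_. 0" "\<lambda>_. 1" "\<Sum>j\<in>?J. M.expectation (Z j)"
      by unfold_locales (use False in \<open>auto intro!: Z_indep simp: Z_def\<close>)
    have mean: "(\<Sum>j\<in>?J. M.expectation (Z j)) = real m * p"
      by (simp add: Z_mean m_def)
    have "A n \<subseteq> {\<omega> \<in> space M. (\<Sum>j\<in>?J. Z j \<omega>) \<ge> (\<Sum>j\<in>?J. M.expectation (Z j)) + p * real n}"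
    proof -
      have "real m * p + p * real n \<le> 2 * p * real n"
        using m(2) p by (simp add: mult.commute)
      then show ?thesis
        unfolding A_def mean by (intro Collect_mono) linarith
    qed
    then have "M.prob (A n) \<le>
        M.prob {\<omega> \<in> space M. (\<Sum>j\<in>?J. Z j \<omega>) \<ge> (\<Sum>j\<in>?J. M.expectation (Z j)) + p * real n}"
    proof (rule M.finite_measure_mono)
      have "(\<lambda>\<omega>. \<Sum>j\<in>?J. Z j \<omega>) \<in> borel_measurable M"
        using Z_borel by (intro borel_measurable_sum) auto
      then show "{\<omega> \<in> space M. (\<Sum>j\<in>?J. Z j \<omega>) \<ge> (\<Sum>j\<in>?J. M.expectation (Z j)) + p * real n} \<in> sets M"
        by measurable
    qed
    also have "\<dots> \<le> exp (-2 * (p * real n)\<^sup>2 / (\<Sum>j\<in>?J. (1 - 0)\<^sup>2))"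
      using p m(1) unfolding m_def by (intro H.Hoeffding_ineq_ge) auto
    \<comment> \<open>There are only \<open>m\<close> \<le> \<open>n\<close> summands, so
      \<open>(p * n)^2 / m\<close> is at least \<open>p^2 * n\<close>: fewer summands only sharpen
      the bound.\<close>
    also have "\<dots> \<le> exp (real n * (- 2 * p\<^sup>2))"
    proof -
      have "real m * (p\<^sup>2 * real n) \<le> real n * (p\<^sup>2 * real n)"
        using m(2) by (intro mult_right_mono) auto
      then have "p\<^sup>2 * real n \<le> (p * real n)\<^sup>2 / real m"
        using m(1) by (simp add: field_simps power2_eq_square)
      then show ?thesis by (simp add: m_def mult_ac)
    qed
    also have "\<dots> = exp (- 2 * p\<^sup>2) ^ n"
      by (rule exp_of_nat_mult)
    finally show ?thesis .
  qed
  have "summable (\<lambda>n. M.prob (A n))"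
  proof (rule summable_comparison_test')
    show "summable (\<lambda>n. exp (- 2 * p\<^sup>2) ^ n)"
      using p by (intro summable_geometric) simp
    show "norm (M.prob (A n)) \<le> exp (- 2 * p\<^sup>2) ^ n" for n
      using A_prob by simp
  qed
  then have "AE \<omega> in M. \<forall>\<^sub>F n in sequentially. \<omega> \<in> space M - A n"
    using A_sets by (intro borel_cantelli_AE1) (auto simp: M.emeasure_eq_measure)
  then show ?thesis
  proof (eventually_elim)
    case (elim \<omega>)
    then show ?case
    proof eventually_elim
      case (elim n)
      have "(\<Sum>j\<in>J \<inter> {1..n}. Z j \<omega>) = real (card {j \<in> J \<inter> {1..n}. \<forall>e\<in>K j. \<omega> e = b})"
        by (simp add: Z_def sum.If_cases Int_def conj_ac)
      then show ?case using elim by (simp add: A_def p_def not_less)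
    qed
  qed
qed

section \<open>Pseudorandom graphs\<close>

text \<open>The only property of the random graph that the deterministic part uses. The flag
  \<open>b\<close> treats common neighbours and common non-neighbours alike; \<open>S\<close> is
  left out because \<open>{a, v}\<close> is no pair when \<open>a = v\<close>.\<close>

definition small_common_sets :: "nat set set \<Rightarrow> bool" where
  "small_common_sets E \<longleftrightarrow>
     (\<forall>S b. finite S \<longrightarrow> S \<subseteq> {1..} \<longrightarrow>
        (\<forall>\<^sub>F n in sequentially.
           real (card {a \<in> ({1..} - S) \<inter> {1..n}. \<forall>v\<in>S. ({a, v} \<in> E) = b})
             \<le> 2 * (1/2) ^ card S * real n))"

text \<open>For fixed \<open>S\<close>, the block of a vertex \<open>a\<close> outside
  \<open>S\<close> consists of the pairs joining it to \<open>S\<close>. There are countably many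
  finite \<open>S\<close>, so the exceptional null sets can be united.\<close>

lemma almost_every_small_common_sets: "almost_every_graph small_common_sets"
proof -
  let ?P = "\<lambda>S b \<omega>. \<forall>\<^sub>F n in sequentially.
           real (card {a \<in> ({1..} - S) \<inter> {1..n}. \<forall>e\<in>(\<lambda>v. {a, v}) ` S. \<omega> e = b})
             \<le> 2 * (1/2) ^ card S * real n"
  have "AE \<omega> in edge_coin_space. ?P S b \<omega>" if S: "finite S" "S \<subseteq> {1..}" for S :: "nat set" and b
    unfolding edge_coin_space_def
  proof (rule AE_coin_blocks)
    show "(\<lambda>v. {a, v}) ` S \<subseteq> all_pairs {1..}" if "a \<in> {1..} - S" for a
      using S that by (auto simp: all_pairs_def)
    show "card ((\<lambda>v. {a, v}) ` S) = card S" for a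
      by (intro card_image) (auto simp: inj_on_def doubleton_eq_iff)
    \<comment> \<open>A pair shared by the blocks of two distinct vertices would consist of these
      two, putting one of them into \<open>S\<close>.\<close>
    show "disjoint_family_on (\<lambda>a. (\<lambda>v. {a, v}) ` S) ({1..} - S)"
      by (auto simp: disjoint_family_on_def doubleton_eq_iff)
  qed (use S in auto)
  then have "AE \<omega> in edge_coin_space. \<forall>S\<in>{S. finite S \<and> S \<subseteq> {1..}}. \<forall>b. ?P S b \<omega>"
    by (subst AE_ball_countable)
      (auto simp: AE_all_countable intro: countable_subset[OF _ countable_Collect_finite])
  then show ?thesis
    unfolding almost_every_graph_def
  proof eventually_elim
    case (elim \<omega>)
    have pair: "{a, v} \<in> all_pairs {1..}" if "a \<in> {1..} - S" "v \<in> S" "S \<subseteq> {1..}" for a v :: nat and S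
      using that by (auto simp: all_pairs_def)
    have "{a \<in> ({1..} - S) \<inter> {1..n}. \<forall>e\<in>(\<lambda>v. {a, v}) ` S. \<omega> e = b} =
        {a \<in> ({1..} - S) \<inter> {1..n}. \<forall>v\<in>S. ({a, v} \<in> {e \<in> all_pairs {1..}. \<omega> e}) = b}"
      if "S \<subseteq> {1..}" for S :: "nat set" and b and n :: nat
      using pair[OF _ _ that] by auto
    then show ?case
      using elim unfolding small_common_sets_def by simp
  qed
qed

text \<open>The exceptional \<open>v\<close> are those related to almost all of \<open>A\<close> in
  the way \<open>b\<close>. Any \<open>r\<close> of them trap \<open>A\<close>, up to density zero,
  in a common class of density at most \<open>2 * (1/2) ^ r\<close>; with infinitely many,
  \<open>r\<close> is arbitrary.\<close>

lemma finite_nonsplitting: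
  assumes E: "small_common_sets E" and A: "A \<subseteq> {1..}" "\<not> density_zero A"
  shows "finite {v \<in> {1..}. density_zero {a \<in> A. ({a, v} \<in> E) \<noteq> b}}" (is "finite ?B")
proof (rule ccontr)
  assume inf: "infinite ?B"
  have "\<forall>\<^sub>F n in sequentially. real (card (A \<inter> {1..n})) \<le> \<epsilon> * real n" if "\<epsilon> > 0" for \<epsilon>
  proof -
    \<comment> \<open>The 3 splits as 1 for the exceptional set \<open>U\<close> and 2 for the
      common class of \<open>S\<close>.\<close>
    obtain r where r: "(1/2 :: real) ^ r < \<epsilon> / 3"
      using real_arch_pow_inv[of "\<epsilon> / 3" "1/2"] \<open>\<epsilon> > 0\<close> by (auto simp del: less_divide_eq_numeral1)
    obtain S where S: "S \<subseteq> ?B" "finite S" "card S = r"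
      using infinite_arbitrarily_large[OF inf] by blast
    \<comment> \<open>\<open>S\<close> itself is added because the common class \<open>?C\<close>
      omits it.\<close>
    define U where "U = (\<Union>v\<in>S. {a \<in> A. ({a, v} \<in> E) \<noteq> b}) \<union> S"
    let ?C = "\<lambda>n. {a \<in> ({1..} - S) \<inter> {1..n}. \<forall>v\<in>S. ({a, v} \<in> E) = b}"
    have "density_zero U"
      unfolding U_def
      by (intro density_zero_Un density_zero_UN) (use S in \<open>auto intro: density_zero_finite\<close>)
    moreover have "(1/2 :: real) ^ r > 0" by simp
    ultimately have "\<forall>\<^sub>F n in sequentially. real (card (U \<inter> {1..n})) \<le> (1/2) ^ r * real n"
      unfolding density_zero_iff by blast
    moreover have "\<forall>\<^sub>F n in sequentially. real (card (?C n)) \<le> 2 * (1/2) ^ r * real n"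
    proof -
      have "S \<subseteq> {1..}" using S(1) by auto
      then show ?thesis using E S(2,3) unfolding small_common_sets_def by blast
    qed
    ultimately show ?thesis
    proof eventually_elim
      case (elim n)
      have "card (A \<inter> {1..n}) \<le> card (U \<inter> {1..n} \<union> ?C n)"
        using A(1) by (intro card_mono) (auto simp: U_def)
      also have "\<dots> \<le> card (U \<inter> {1..n}) + card (?C n)"
        by (rule card_Un_le)
      finally have "real (card (A \<inter> {1..n})) \<le> 3 * (1/2) ^ r * real n"
        using elim by linarith
      also have "\<dots> \<le> \<epsilon> * real n"
        using r by (intro mult_right_mono) auto
      finally show ?case .
    qed
  qed
  then show False using A(2) by (auto simp: density_zero_iff)
qed

section \<open>The greedy embedding\<close>

text \<open>\<open>T\<close> encodes a 0-1 pattern over the first \<open>n\<close> chosen vertices.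
  Only its part below \<open>n\<close> matters, so one \<open>T\<close> can serve at all
  stages.\<close>

definition adjacency_class :: "nat set set \<Rightarrow> nat set \<Rightarrow> (nat \<Rightarrow> nat) \<Rightarrow> nat \<Rightarrow> nat set \<Rightarrow> nat set" where
  "adjacency_class E A f n T = {a \<in> A. \<forall>i<n. {a, f i} \<in> E \<longleftrightarrow> i \<in> T}"

lemma greedy_embedding:
  fixes F :: "nat set set"
  assumes E: "small_common_sets E" and A: "A \<subseteq> {1..}" "\<not> density_zero A"
  shows "\<exists>f. \<forall>n. f n \<in> A \<and> f n \<notin> f ` {..<n} \<and> (\<forall>i<n. {f n, f i} \<in> E \<longleftrightarrow> {n, i} \<in> F)"
proof -
  \<comment> \<open>The last conjunct is the invariant for stage \<open>n + 1\<close>, written with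
    \<open>v\<close> in place of \<open>f n\<close>. So \<open>P f n v\<close> depends only on
    \<open>f\<close> below \<open>n\<close>, as the recursive choice requires.\<close>
  define P where "P f n v \<longleftrightarrow>
      v \<in> A \<and> v \<notin> f ` {..<n} \<and> (\<forall>i<n. {v, f i} \<in> E \<longleftrightarrow> {n, i} \<in> F) \<and>
      (\<forall>T. \<not> density_zero {a \<in> adjacency_class E A f n T. {a, v} \<in> E \<longleftrightarrow> n \<in> T})"
    for f :: "nat \<Rightarrow> nat" and n v
  have step: "\<exists>v. P f n v" if "\<forall>T. \<not> density_zero (adjacency_class E A f n T)" for f n
  proof -
    define bad where "bad b T =
      {v \<in> {1..}. density_zero {a \<in> adjacency_class E A f n T. ({a, v} \<in> E) \<noteq> b}}" for b T
    \<comment> \<open>Only finitely many patterns live below \<open>n\<close>, so finitely many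
      finite bad sets, together with the vertices already used, have to be avoided.\<close>
    define X where "X = (\<Union>b. \<Union>T\<in>Pow {..<n}. bad b T) \<union> f ` {..<n}"
    have "finite (bad b T)" for b T
      unfolding bad_def using A(1) that
      by (intro finite_nonsplitting E) (auto simp: adjacency_class_def)
    then have "finite X" unfolding X_def by auto
    \<comment> \<open>The candidates for \<open>f n\<close> are the vertices whose pattern is row
      \<open>n\<close> of \<open>F\<close>; this class is not null, so some candidate avoids
      \<open>X\<close>.\<close>
    moreover have "infinite (adjacency_class E A f n {i. {n, i} \<in> F})"
      using that density_zero_finite by blast
    ultimately obtain v where v: "v \<in> adjacency_class E A f n {i. {n, i} \<in> F}" "v \<notin> X"
      by (meson finite_subset subsetI)
    have "\<not> density_zero {a \<in> adjacency_class E A f n T. {a, v} \<in> E \<longleftrightarrow> n \<in> T}" for T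
    proof -
      have T: "adjacency_class E A f n (T \<inter> {..<n}) = adjacency_class E A f n T"
        by (auto simp: adjacency_class_def)
      \<comment> \<open>The wanted condition
        \<open>{a, v} \<in> E \<longleftrightarrow> n \<in> T\<close> says that adjacency differs
        from the truth value of \<open>n \<notin> T\<close>, hence this flag.\<close>
      have "v \<notin> bad (n \<notin> T) (T \<inter> {..<n})" using v(2) by (auto simp: X_def)
      moreover have "v \<in> {1..}" using v(1) A(1) by (auto simp: adjacency_class_def)
      ultimately show ?thesis by (auto simp: bad_def T)
    qed
    then show ?thesis
      using v by (intro exI[of _ v]) (auto simp: P_def adjacency_class_def X_def)
  qed
  have "\<exists>f. \<forall>n. P f n (f n)"
  proof (rule dependent_wellorder_choice)
    fix r n and f g :: "nat \<Rightarrow> nat" assume eq: "\<And>y. y < n \<Longrightarrow> f y = g y"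
    then have "f ` {..<n} = g ` {..<n}" "adjacency_class E A f n = adjacency_class E A g n"
      by (auto simp: adjacency_class_def fun_eq_iff)
    then show "P f n r = P g n r"
      using eq by (simp add: P_def)
  next
    fix n f assume prev: "\<And>y. y < n \<Longrightarrow> P f y (f y)"
    show "\<exists>r. P f n r"
    proof (rule step, cases n)
      case 0
      then show "\<forall>T. \<not> density_zero (adjacency_class E A f n T)"
        using A(2) by (simp add: adjacency_class_def)
    next
      case (Suc m)
      have "adjacency_class E A f n T = {a \<in> adjacency_class E A f m T. {a, f m} \<in> E \<longleftrightarrow> m \<in> T}" for T
        by (auto simp: adjacency_class_def Suc less_Suc_eq)
      then show "\<forall>T. \<not> density_zero (adjacency_class E A f n T)"
        using prev[of m] by (simp add: P_def Suc)
    qed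
  qed
  then obtain f where "\<forall>n. P f n (f n)" ..
  then show ?thesis
    by (intro exI[of _ f]) (simp add: P_def)
qed

text \<open>All of \<open>nat\<close> is embedded, numbers outside \<open>W\<close> counting as
  isolated vertices of \<open>F\<close>; the copy of \<open>W\<close> is its image.\<close>

lemma universal_if_not_density_zero:
  assumes E: "small_common_sets E" "E \<subseteq> all_pairs {1..}" and A: "A \<subseteq> {1..}" "\<not> density_zero A"
  shows "universal E A"
  unfolding universal_def contains_induced_def graph_isomorphic_def
proof (intro allI impI)
  fix W :: "nat set" and F assume F: "simple_graph W F"
  obtain f where "\<forall>n. f n \<in> A \<and> f n \<notin> f ` {..<n} \<and> (\<forall>i<n. {f n, f i} \<in> E \<longleftrightarrow> {n, i} \<in> F)"
    using greedy_embedding[OF E(1) A] ..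
  then have f: "f n \<in> A" "f n \<notin> f ` {..<n}" "i < n \<Longrightarrow> {f n, f i} \<in> E \<longleftrightarrow> {n, i} \<in> F" for n i
    by simp_all
  have "inj f"
    by (rule linorder_injI) (metis f(2) imageI lessThan_iff)
  have irrefl: "{u} \<notin> F" "{u} \<notin> E" for u
    using F E(2) by (auto simp: simple_graph_def all_pairs_def)
  \<comment> \<open>The greedy choice controls only pairs with \<open>i < n\<close>; unordered pairs
    give the other order, and the absence of loops in \<open>F\<close> and \<open>E\<close> settles
    \<open>u = v\<close>.\<close>
  have edge: "{u, v} \<in> F \<longleftrightarrow> {f u, f v} \<in> E" for u v
    by (cases u v rule: linorder_cases) (use f(3)[of u v] f(3)[of v u] irrefl in \<open>auto simp: insert_commute\<close>)
  show "\<exists>B\<subseteq>A. \<exists>f. bij_betw f W B \<and>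
      (\<forall>u\<in>W. \<forall>v\<in>W. {u, v} \<in> F \<longleftrightarrow> {f u, f v} \<in> induced_edges (induced_edges E A) B)"
  proof (intro exI conjI)
    show "f ` W \<subseteq> A" using f(1) by blast
    show "bij_betw f W (f ` W)"
      using inj_on_subset[OF \<open>inj f\<close>] by (simp add: bij_betw_def)
    show "\<forall>u\<in>W. \<forall>v\<in>W. {u, v} \<in> F \<longleftrightarrow> {f u, f v} \<in> induced_edges (induced_edges E A) (f ` W)"
      using f(1) by (simp add: induced_edges_def edge)
  qed
qed

theorem theorem1:
  shows "almost_every_graph
           (\<lambda>E. \<forall>A\<subseteq>{1..}. upper_density A > 0 \<longrightarrow> universal E A)"
  using almost_every_small_common_sets unfolding almost_every_graph_def
proof eventually_elim
  case (elim \<omega>)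
  then show ?case
    by (auto simp: upper_density_pos_iff intro!: universal_if_not_density_zero)
qed

end
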